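(* Let $\Psi=\sqrt{\rho}\,e^{iS/\hbar}$ be an $n$-body wavefunction with associated velocities $\mathbf u_i,\mathbf v_i$, pressures $P_i,p_i$, and energy fields $E,F$ as defined in the context, and let $U$ be a real-valued potential. Consider the Schr\"odinger equation in the form $i\hbar\Psi^*\partial\Psi=\Psi^*\hat H\Psi$. Then: (a) its real part, $\mathrm{Re}(i\hbar\Psi^*\partial\Psi)=\mathrm{Re}(\Psi^*\hat H\Psi)$, is equivalent to the energy equation $$E\rho=\sum_{i=1}^n\Big(\tfrac12\rho_m|\mathbf u_i|^2+\tfrac12\rho_m|\mathbf v_i|^2+P_i\Big)+U\rho ;$$ (b) its imaginary part, $\mathrm{Im}(i\hbar\Psi^*\partial\Psi)=\mathrm{Im}(\Psi^*\hat H\Psi)$, is equivalent to $$F\rho=\sum_{i=1}^n p_i .$$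
   Context: Constants $\hbar,m>0$ and an integer $n\ge1$. Points of $\mathbb R\times\mathbb R^{3n}$ are $(t,\mathbf r_1,\dots,\mathbf r_n)$; spin variables are fixed parameters and suppressed. $\partial=\partial/\partial t$ and $\nabla_i$ is the gradient in $\mathbf r_i\in\mathbb R^3$. $\rho\ge0$ and $S$ are real functions, twice continuously differentiable almost everywhere; the zero set of $\rho$ has measure zero for each time, $\Psi$ and its first derivatives vanish at infinity, $\Psi$ is square integrable, and $\rho=\Psi^*\Psi$ is normalized to one. All equalities are understood almost everywhere. Definitions: $\zeta_0=\hbar/2$, $\zeta=\zeta_0/m$, $\rho_m=m\rho$, $\theta=-\zeta_0\ln\rho$; $\mathbf v_i=\frac1m\nabla_iS$, $\mathbf u_i=\frac1m\nabla_i\theta=-\zeta\,\nabla_i\rho/\rho$; $P_i=\zeta_0\nabla_i\cdot(\rho\mathbf u_i)=-\zeta\zeta_0\nabla_i^2\rho$, $p_i=-\zeta_0\nabla_i\cdot(\rho\mathbf v_i)$; $E=-\partial S$, $F=-\partial\theta$ (so $F\rho=\zeta_0\,\partial\rho$). The Hamiltonian operator is $\hat H=-\frac{\hbar^2}{2m}\sum_{i=1}^n\nabla_i^2+U$. *)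

theory Defs
  imports "HOL-Analysis.Analysis"
begin

text \<open>A point \<open>(t, r)\<close> of \<open>\<real> \<times> \<real>\<^sup>3\<^sup>n\<close>, with \<open>n = CARD('n)\<close> and \<open>r $ i\<close> the position of particle \<open>i\<close>.\<close>

type_synonym 'n config = "(real^3)^'n"
type_synonym 'n event = "real \<times> 'n config"

section \<open>Differential operators\<close>

definition dir_deriv ::
    "'a::real_normed_vector \<Rightarrow> ('a \<Rightarrow> 'b::real_normed_vector) \<Rightarrow> 'a \<Rightarrow> 'b" where
  "dir_deriv d f x = vector_derivative (\<lambda>s. f (x + s *\<^sub>R d)) (at 0)"

definition time_deriv :: "('n::finite event \<Rightarrow> 'b::real_normed_vector) \<Rightarrow> 'n event \<Rightarrow> 'b" where
  "time_deriv = dir_deriv (1, 0)"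

definition space_deriv ::
    "'n \<Rightarrow> 3 \<Rightarrow> ('n::finite event \<Rightarrow> 'b::real_normed_vector) \<Rightarrow> 'n event \<Rightarrow> 'b" where
  "space_deriv i k = dir_deriv (0, axis i (axis k 1))"

definition grad :: "'n \<Rightarrow> ('n::finite event \<Rightarrow> 'b::real_normed_vector) \<Rightarrow> 'n event \<Rightarrow> 'b^3" where
  "grad i f x = (\<chi> k. space_deriv i k f x)"

definition divergence ::
    "'n \<Rightarrow> ('n::finite event \<Rightarrow> 'b::real_normed_vector^3) \<Rightarrow> 'n event \<Rightarrow> 'b" where
  "divergence i w x = (\<Sum>k\<in>UNIV. space_deriv i k (\<lambda>y. w y $ k) x)"

definition laplacian :: "'n \<Rightarrow> ('n::finite event \<Rightarrow> 'b::real_normed_vector) \<Rightarrow> 'n event \<Rightarrow> 'b" where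
  "laplacian i f = divergence i (grad i f)"

section \<open>Regularity and decay\<close>

definition C2_on :: "('a::real_normed_vector \<Rightarrow> 'b::real_normed_vector) \<Rightarrow> 'a set \<Rightarrow> bool" where
  "C2_on f G \<longleftrightarrow>
     (\<exists>(f' :: 'a \<Rightarrow> 'a \<Rightarrow>\<^sub>L 'b) (f'' :: 'a \<Rightarrow> 'a \<Rightarrow>\<^sub>L ('a \<Rightarrow>\<^sub>L 'b)).
        (\<forall>x\<in>G. (f has_derivative blinfun_apply (f' x)) (at x)) \<and>
        (\<forall>x\<in>G. (f' has_derivative blinfun_apply (f'' x)) (at x)) \<and>
        continuous_on G f'')"

text \<open>Continuity of the second derivative at a point presupposes that it exists nearby,
  so the exceptional null set is taken to be closed.\<close>

definition C2_ae :: "('a::euclidean_space \<Rightarrow> 'b::real_normed_vector) \<Rightarrow> bool" where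
  "C2_ae f \<longleftrightarrow> (\<exists>G. open G \<and> - G \<in> null_sets lebesgue \<and> C2_on f G)"

text \<open>Decay is as \<open>r\<close> goes to infinity at fixed time. Since \<open>vector_derivative\<close> has an
  unspecified value where there is no derivative, the limits of the derivatives run only
  over points of differentiability.\<close>

definition vanishes_at_infinity ::
    "('n::finite event \<Rightarrow> 'b::real_normed_vector) \<Rightarrow> bool" where
  "vanishes_at_infinity f \<longleftrightarrow> (\<forall>t. ((\<lambda>r. f (t, r)) \<longlongrightarrow> 0) at_infinity)"

definition derivs_vanish_at_infinity ::
    "('n::finite event \<Rightarrow> 'b::real_normed_vector) \<Rightarrow> bool" where
  "derivs_vanish_at_infinity f \<longleftrightarrow>
     (\<forall>t. let \<F> = inf at_infinity (principal {r. f differentiable (at (t, r))}) in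
        ((\<lambda>r. time_deriv f (t, r)) \<longlongrightarrow> 0) \<F> \<and>
        (\<forall>i. ((\<lambda>r. grad i f (t, r)) \<longlongrightarrow> 0) \<F>))"

section \<open>Wavefunction and Hamiltonian\<close>

definition wavefun ::
    "real \<Rightarrow> ('n event \<Rightarrow> real) \<Rightarrow> ('n event \<Rightarrow> real) \<Rightarrow> 'n::finite event \<Rightarrow> complex" where
  "wavefun hbar \<rho> S x =
     complex_of_real (sqrt (\<rho> x)) * exp (\<i> * complex_of_real (S x / hbar))"

definition hamiltonian ::
    "real \<Rightarrow> real \<Rightarrow> ('n event \<Rightarrow> real) \<Rightarrow> ('n event \<Rightarrow> complex) \<Rightarrow> 'n::finite event \<Rightarrow> complex" where
  "hamiltonian hbar m U \<psi> x =
     - complex_of_real (hbar\<^sup>2 / (2 * m)) * (\<Sum>i\<in>UNIV. laplacian i \<psi> x)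
     + complex_of_real (U x) * \<psi> x"

section \<open>Velocities, pressures and energy fields\<close>

definition zeta0 :: "real \<Rightarrow> real" where
  "zeta0 hbar = hbar / 2"

definition mass_density :: "real \<Rightarrow> ('n event \<Rightarrow> real) \<Rightarrow> 'n::finite event \<Rightarrow> real" where
  "mass_density m \<rho> x = m * \<rho> x"

definition theta :: "real \<Rightarrow> ('n event \<Rightarrow> real) \<Rightarrow> 'n::finite event \<Rightarrow> real" where
  "theta hbar \<rho> x = - zeta0 hbar * ln (\<rho> x)"

definition vel_v :: "real \<Rightarrow> ('n event \<Rightarrow> real) \<Rightarrow> 'n \<Rightarrow> 'n::finite event \<Rightarrow> real^3" where
  "vel_v m S i x = (1 / m) *\<^sub>R grad i S x"

definition vel_u :: "real \<Rightarrow> real \<Rightarrow> ('n event \<Rightarrow> real) \<Rightarrow> 'n \<Rightarrow> 'n::finite event \<Rightarrow> real^3" where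
  "vel_u hbar m \<rho> i x = (1 / m) *\<^sub>R grad i (theta hbar \<rho>) x"

definition pressure_P :: "real \<Rightarrow> real \<Rightarrow> ('n event \<Rightarrow> real) \<Rightarrow> 'n \<Rightarrow> 'n::finite event \<Rightarrow> real" where
  "pressure_P hbar m \<rho> i x =
     zeta0 hbar * divergence i (\<lambda>y. \<rho> y *\<^sub>R vel_u hbar m \<rho> i y) x"

definition pressure_p ::
    "real \<Rightarrow> real \<Rightarrow> ('n event \<Rightarrow> real) \<Rightarrow> ('n event \<Rightarrow> real) \<Rightarrow> 'n \<Rightarrow> 'n::finite event \<Rightarrow> real" where
  "pressure_p hbar m \<rho> S i x =
     - zeta0 hbar * divergence i (\<lambda>y. \<rho> y *\<^sub>R vel_v m S i y) x"

definition energy_E :: "('n event \<Rightarrow> real) \<Rightarrow> 'n::finite event \<Rightarrow> real" where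
  "energy_E S x = - time_deriv S x"

definition energy_F :: "real \<Rightarrow> ('n event \<Rightarrow> real) \<Rightarrow> 'n::finite event \<Rightarrow> real" where
  "energy_F hbar \<rho> x = - time_deriv (theta hbar \<rho>) x"

end

theory Submission
  imports Defs
begin

text \<open>Off a null set the density is positive and \<open>\<rho>\<close> and \<open>S\<close> are \<open>C\<^sup>2\<close>; there the derivative
  of \<open>\<Psi>\<close> in a direction \<open>d\<close> is \<open>\<Psi> (\<rho>\<^sub>d / 2\<rho> + \<i> S\<^sub>d / hbar)\<close>. Differentiating
  twice and using \<open>\<Psi>\<^sup>* \<Psi> = \<rho>\<close>, both equivalences become pointwise identities between the
  corresponding sides. That \<open>\<rho>\<close> vanishes only on a null set of space-time follows from the
  assumption on its time slices by Fubini's theorem.\<close>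

section \<open>Directional derivatives\<close>

lemma dir_deriv_eqI:
  assumes "((\<lambda>s. f (x + s *\<^sub>R d)) has_vector_derivative v) (at 0)"
  shows "dir_deriv d f x = v"
  using assms unfolding dir_deriv_def by (rule vector_derivative_at)

lemma eventually_on_line:
  fixes x d :: "'a::real_normed_vector"
  assumes "open W" "x \<in> W"
  shows "\<forall>\<^sub>F s in nhds 0. x + s *\<^sub>R d \<in> W"
proof -
  have "((\<lambda>s. x + s *\<^sub>R d) \<longlongrightarrow> x + 0 *\<^sub>R d) (nhds 0)"
    by (intro tendsto_intros filterlim_ident)
  then show ?thesis
    using assms by (intro topological_tendstoD) auto
qed

text \<open>A short segment of the line through \<open>x\<close> stays inside the open set
  \<open>W\<close>, so a formula known only on \<open>W\<close> may replace \<open>f\<close> before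
  differentiating. This is how first derivatives computed on \<open>W\<close> get differentiated a
  second time.\<close>

lemma has_vector_derivative_line_cong:
  fixes x d :: "'a::real_normed_vector"
  assumes "open W" "x \<in> W" "\<And>y. y \<in> W \<Longrightarrow> f y = g y"
    and "((\<lambda>s. g (x + s *\<^sub>R d)) has_vector_derivative v) (at 0)"
  shows "((\<lambda>s. f (x + s *\<^sub>R d)) has_vector_derivative v) (at 0)"
proof -
  have "\<forall>\<^sub>F s in nhds 0. f (x + s *\<^sub>R d) = g (x + s *\<^sub>R d)"
    using eventually_on_line[OF assms(1,2), of d] by eventually_elim (rule assms(3))
  then have "((\<lambda>s. f (x + s *\<^sub>R d)) has_vector_derivative v) (at 0) \<longleftrightarrow>
      ((\<lambda>s. g (x + s *\<^sub>R d)) has_vector_derivative v) (at 0)"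
    using assms(2,3) by (intro has_vector_derivative_cong_ev) (auto elim: eventually_mono)
  then show ?thesis
    using assms(4) by simp
qed

lemma has_derivative_line:
  assumes "(f has_derivative D) (at x)"
  shows "((\<lambda>s. f (x + s *\<^sub>R d)) has_vector_derivative D d) (at 0)"
proof -
  have "((\<lambda>s. x + s *\<^sub>R d) has_derivative (\<lambda>s. s *\<^sub>R d)) (at 0)"
    by (auto intro!: derivative_eq_intros)
  moreover have "(f has_derivative D) (at (x + 0 *\<^sub>R d))"
    using assms by simp
  ultimately have "((\<lambda>s. f (x + s *\<^sub>R d)) has_derivative (\<lambda>s. D (s *\<^sub>R d))) (at 0)"
    by (rule has_derivative_compose)
  then show ?thesis
    using linear_scale[OF has_derivative_linear[OF assms]]
    by (simp add: has_vector_derivative_def)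
qed

lemma C2_on_dir_deriv:
  assumes "C2_on f G" "x \<in> G"
  shows "((\<lambda>s. f (x + s *\<^sub>R d)) has_vector_derivative dir_deriv d f x) (at 0)"
proof -
  obtain D where "(f has_derivative D) (at x)"
    using assms unfolding C2_on_def by blast
  from has_derivative_line[OF this] show ?thesis
    using dir_deriv_eqI by metis
qed

text \<open>On \<open>G\<close> the first directional derivative is \<open>f'\<close> evaluated at
  the fixed vector \<open>e\<close>. Evaluation is bounded linear, so differentiability of
  \<open>f'\<close> passes to it; openness of \<open>G\<close> makes the formula available near
  \<open>x\<close>.\<close>

lemma C2_on_dir_deriv2:
  assumes "C2_on f G" "open G" "x \<in> G"
  shows "((\<lambda>s. dir_deriv e f (x + s *\<^sub>R d)) has_vector_derivative
            dir_deriv d (dir_deriv e f) x) (at 0)"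
proof -
  obtain f' f'' where f': "\<And>y. y \<in> G \<Longrightarrow> (f has_derivative blinfun_apply (f' y)) (at y)"
    and f'': "(f' has_derivative blinfun_apply f'') (at x)"
    using assms unfolding C2_on_def by metis
  have eq: "dir_deriv e f y = blinfun_apply (f' y) e" if "y \<in> G" for y
    using has_derivative_line[OF f'[OF that]] by (rule dir_deriv_eqI)
  have "((\<lambda>y. blinfun_apply (f' y) e) has_derivative (\<lambda>h. blinfun_apply (f'' h) e)) (at x)"
    using f'' by (auto intro!: derivative_eq_intros)
  from has_vector_derivative_line_cong[OF assms(2,3) eq has_derivative_line[OF this]]
  have "((\<lambda>s. dir_deriv e f (x + s *\<^sub>R d)) has_vector_derivative blinfun_apply (f'' d) e) (at 0)" .
  then show ?thesis
    using dir_deriv_eqI by metis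
qed

lemma C2_on_subset: "C2_on f G \<Longrightarrow> H \<subseteq> G \<Longrightarrow> C2_on f H"
  unfolding C2_on_def by (meson continuous_on_subset subsetD)

lemma C2_on_imp_continuous_on: "C2_on f G \<Longrightarrow> continuous_on G f"
  unfolding C2_on_def by (blast intro: continuous_at_imp_continuous_on has_derivative_continuous)

section \<open>The zero set of the density\<close>

text \<open>Tonelli: the measure of \<open>A\<close> is the integral of the measures of its slices.
  Slices of a Borel set are Borel, and on those \<open>lebesgue\<close> and \<open>lborel\<close>
  agree.\<close>

lemma null_sets_lborel_of_slices:
  fixes A :: "('a::euclidean_space \<times> 'b::euclidean_space) set"
  assumes "A \<in> sets borel" "\<And>t. {r. (t, r) \<in> A} \<in> null_sets lebesgue"
  shows "A \<in> null_sets lborel"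
proof -
  have A: "A \<in> sets (lborel \<Otimes>\<^sub>M lborel)"
    using assms(1) unfolding lborel_prod by simp
  have slice: "emeasure lborel (Pair t -` A) = 0" for t
  proof -
    have "Pair t -` A \<in> sets lborel"
      using sets_Pair1[OF A] .
    then show ?thesis
      using assms(2)[of t] by (simp add: null_sets_def vimage_def)
  qed
  have "emeasure (lborel \<Otimes>\<^sub>M lborel) A = (\<integral>\<^sup>+ t. emeasure lborel (Pair t -` A) \<partial>lborel)"
    using A by (rule lborel.emeasure_pair_measure_alt)
  then have "emeasure lborel A = 0"
    by (simp add: slice lborel_prod)
  then show ?thesis
    using assms(1) by (simp add: null_sets_def)
qed

lemma AE_positive_C2:
  fixes \<rho> S :: "'a::euclidean_space \<times> 'b::euclidean_space \<Rightarrow> real"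
  assumes nonneg: "\<And>x. \<rho> x \<ge> 0" and "C2_ae \<rho>" "C2_ae S"
    and zeros: "\<And>t. {r. \<rho> (t, r) = 0} \<in> null_sets lebesgue"
  obtains W where "open W" "AE x in lebesgue. x \<in> W" "C2_on \<rho> W" "C2_on S W"
    "\<And>x. x \<in> W \<Longrightarrow> \<rho> x > 0"
proof -
  obtain G H where G: "open G" "- G \<in> null_sets lebesgue" "C2_on \<rho> G"
    and H: "open H" "- H \<in> null_sets lebesgue" "C2_on S H"
    using assms unfolding C2_ae_def by metis
  define W where "W = (G \<inter> H) \<inter> \<rho> -` {0<..}"
  have cont: "continuous_on (G \<inter> H) \<rho>"
    using C2_on_imp_continuous_on[OF G(3)] by (rule continuous_on_subset) auto
  have "open W"
    unfolding W_def using cont G(1) H(1) by (intro continuous_open_preimage) auto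
  \<comment> \<open>Tonelli is applied to this difference of open sets, which is Borel; the full
    zero set of \<open>\<rho>\<close> might not be, since \<open>\<rho>\<close> is uncontrolled off
    \<open>G\<close>.\<close>
  have "G \<inter> H - W \<in> null_sets lborel"
  proof (rule null_sets_lborel_of_slices)
    show "G \<inter> H - W \<in> sets borel"
      using G(1) H(1) \<open>open W\<close> by auto
    show "{r. (t, r) \<in> G \<inter> H - W} \<in> null_sets lebesgue" for t
    \<comment> \<open>Completeness of Lebesgue measure is used: each slice lies in a null zero set,
      since a nonnegative value that is not positive is zero.\<close>
    proof (rule null_sets_completion_subset[OF _ zeros])
      show "{r. (t, r) \<in> G \<inter> H - W} \<subseteq> {r. \<rho> (t, r) = 0}"
        using nonneg by (auto simp: W_def not_less intro: antisym)
    qed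
  qed
  then have "G \<inter> H - W \<in> null_sets lebesgue"
    by (rule null_sets_completionI)
  then have "AE x in lebesgue. x \<in> W"
    using AE_not_in[OF G(2)] AE_not_in[OF H(2)] by (auto dest!: AE_not_in)
  then show thesis
    using \<open>open W\<close> C2_on_subset[OF G(3), of W] C2_on_subset[OF H(3), of W]
    by (intro that) (auto simp: W_def)
qed

section \<open>Derivatives of the wavefunction\<close>

text \<open>Logarithmic differentiation: the modulus contributes \<open>r / (2 * R a)\<close> and
  the phase \<open>\<i> * \<tau> / h\<close>. Keeping the function itself as a factor prepares for
  the second derivative.\<close>

lemma polar_has_vector_derivative:
  fixes R T :: "real \<Rightarrow> real"
  assumes R: "(R has_vector_derivative r) (at a)" and T: "(T has_vector_derivative \<tau>) (at a)"
    and "R a > 0"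
  shows "((\<lambda>s. complex_of_real (sqrt (R s)) * exp (\<i> * complex_of_real (T s / h)))
      has_vector_derivative
        complex_of_real (sqrt (R a)) * exp (\<i> * complex_of_real (T a / h))
          * (complex_of_real (r / (2 * R a)) + \<i> * complex_of_real (\<tau> / h))) (at a)"
proof -
  \<comment> \<open>The usual \<open>r / (2 * sqrt (R a))\<close> is rewritten, using
    \<open>R a > 0\<close>, so that \<open>sqrt (R a)\<close> factors out.\<close>
  have "((\<lambda>s. sqrt (R s)) has_real_derivative sqrt (R a) * (r / (2 * R a))) (at a)"
    using R \<open>R a > 0\<close> unfolding has_real_derivative_iff_has_vector_derivative[symmetric]
    by (auto intro!: derivative_eq_intros simp: field_simps)
  note sqrt = has_vector_derivative_of_real[OF this, where 'a = complex]
  have "((\<lambda>s. T s / h) has_real_derivative \<tau> / h) (at a)"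
    using T unfolding has_real_derivative_iff_has_vector_derivative[symmetric]
    by (rule DERIV_cdivide)
  from has_vector_derivative_mult_right[OF has_vector_derivative_of_real[OF this], of \<i>]
  have phase: "((\<lambda>s. \<i> * complex_of_real (T s / h))
      has_vector_derivative \<i> * complex_of_real (\<tau> / h)) (at a)" .
  \<comment> \<open>A mixed chain rule is used: the inner function has a real parameter, while
    \<open>exp\<close> is differentiated over the complex numbers.\<close>
  have "((exp \<circ> (\<lambda>s. \<i> * complex_of_real (T s / h))) has_vector_derivative
      \<i> * complex_of_real (\<tau> / h) * exp (\<i> * complex_of_real (T a / h))) (at a)"
    by (rule field_vector_diff_chain_at[OF phase DERIV_exp])
  from has_vector_derivative_mult[OF sqrt this] show ?thesis
    by (simp add: o_def algebra_simps)
qed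

lemma cnj_mult_wavefun:
  assumes "\<rho> x \<ge> 0"
  shows "cnj (wavefun h \<rho> S x) * wavefun h \<rho> S x = complex_of_real (\<rho> x)"
proof -
  have "cmod (wavefun h \<rho> S x) = sqrt (\<rho> x)"
    using assms by (simp add: wavefun_def norm_mult)
  then show ?thesis
    using assms complex_norm_square[of "wavefun h \<rho> S x"] by (simp add: mult.commute)
qed

section \<open>Pointwise calculus on an open set of positive density\<close>

context
  fixes \<rho> S :: "'n::finite event \<Rightarrow> real" and W :: "'n event set"
  assumes W: "open W" and rho: "C2_on \<rho> W" and S: "C2_on S W"
    and pos: "\<And>x. x \<in> W \<Longrightarrow> \<rho> x > 0"
begin

lemma wavefun_dir_deriv_line:
  assumes "x \<in> W"
  shows "((\<lambda>s. wavefun h \<rho> S (x + s *\<^sub>R d)) has_vector_derivative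
    wavefun h \<rho> S x * (complex_of_real (dir_deriv d \<rho> x / (2 * \<rho> x))
      + \<i> * complex_of_real (dir_deriv d S x / h))) (at 0)"
  using polar_has_vector_derivative[OF C2_on_dir_deriv[OF rho assms] C2_on_dir_deriv[OF S assms], where h = h]
    pos[OF assms] by (simp add: wavefun_def)

lemmas wavefun_dir_deriv = dir_deriv_eqI[OF wavefun_dir_deriv_line]

text \<open>Write L for the logarithmic derivative in direction \<open>d\<close>. The first
  derivative is the wavefunction times L, so the second is the wavefunction times L squared plus the
  derivative of L.\<close>

lemma wavefun_dir_deriv2:
  fixes d :: "'n event"
  assumes "x \<in> W"
  defines "a \<equiv> dir_deriv d \<rho> x" and "b \<equiv> dir_deriv d S x"
    and "a' \<equiv> dir_deriv d (dir_deriv d \<rho>) x" and "b' \<equiv> dir_deriv d (dir_deriv d S) x"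
  shows "dir_deriv d (dir_deriv d (wavefun h \<rho> S)) x = wavefun h \<rho> S x *
    ((complex_of_real (a / (2 * \<rho> x)) + \<i> * complex_of_real (b / h))\<^sup>2
      + (complex_of_real (a' / (2 * \<rho> x) - a\<^sup>2 / (2 * (\<rho> x)\<^sup>2)) + \<i> * complex_of_real (b' / h)))"
proof (rule dir_deriv_eqI, rule has_vector_derivative_line_cong[OF W assms(1) wavefun_dir_deriv])
  have "((\<lambda>s. dir_deriv d \<rho> (x + s *\<^sub>R d) / (2 * \<rho> (x + s *\<^sub>R d))) has_real_derivative
      a' / (2 * \<rho> x) - a\<^sup>2 / (2 * (\<rho> x)\<^sup>2)) (at 0)"
    using C2_on_dir_deriv[OF rho assms(1), of d] C2_on_dir_deriv2[OF rho W assms(1), of d d]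
      pos[OF assms(1)]
    unfolding has_real_derivative_iff_has_vector_derivative[symmetric]
    by (auto intro!: derivative_eq_intros simp: a_def a'_def field_simps power2_eq_square)
  note re = has_vector_derivative_of_real[OF this, where 'a = complex]
  have "((\<lambda>s. dir_deriv d S (x + s *\<^sub>R d) / h) has_real_derivative b' / h) (at 0)"
    using C2_on_dir_deriv2[OF S W assms(1), of d d]
    unfolding has_real_derivative_iff_has_vector_derivative[symmetric] b'_def
    by (rule DERIV_cdivide)
  note im = has_vector_derivative_mult_right[OF has_vector_derivative_of_real[OF this], of \<i>]
  from has_vector_derivative_mult[OF wavefun_dir_deriv_line[OF assms(1), of h d]
      has_vector_derivative_add[OF re im]]
  show "((\<lambda>s. wavefun h \<rho> S (x + s *\<^sub>R d)
        * (complex_of_real (dir_deriv d \<rho> (x + s *\<^sub>R d) / (2 * \<rho> (x + s *\<^sub>R d)))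
          + \<i> * complex_of_real (dir_deriv d S (x + s *\<^sub>R d) / h))) has_vector_derivative
      wavefun h \<rho> S x *
      ((complex_of_real (a / (2 * \<rho> x)) + \<i> * complex_of_real (b / h))\<^sup>2
      + (complex_of_real (a' / (2 * \<rho> x) - a\<^sup>2 / (2 * (\<rho> x)\<^sup>2)) + \<i> * complex_of_real (b' / h)))) (at 0)"
    by (simp add: a_def b_def algebra_simps power2_eq_square)
qed

lemma cnj_wavefun_dir_deriv:
  assumes "x \<in> W" "h > 0"
  shows "cnj (wavefun h \<rho> S x) * dir_deriv d (wavefun h \<rho> S) x
    = Complex (dir_deriv d \<rho> x / 2) (\<rho> x * dir_deriv d S x / h)"
  using pos[OF assms(1)] assms(2)
  by (simp add: wavefun_dir_deriv[OF assms(1)] mult.assoc[symmetric] cnj_mult_wavefun complex_eq_iff)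

text \<open>The conjugate factor turns the wavefunction into \<open>\<rho> x\<close> and removes the
  phase. In the real part the squared derivative of \<open>\<rho>\<close> appears with coefficient
  1/4 from the square of L and -1/2 from the derivative of L, leaving -1/4.\<close>

lemma cnj_wavefun_dir_deriv2:
  assumes "x \<in> W" "h > 0"
  shows "cnj (wavefun h \<rho> S x) * dir_deriv d (dir_deriv d (wavefun h \<rho> S)) x
    = Complex (dir_deriv d (dir_deriv d \<rho>) x / 2 - (dir_deriv d \<rho> x)\<^sup>2 / (4 * \<rho> x)
          - \<rho> x * (dir_deriv d S x)\<^sup>2 / h\<^sup>2)
        ((dir_deriv d \<rho> x * dir_deriv d S x + \<rho> x * dir_deriv d (dir_deriv d S) x) / h)"
proof -
  have eq: "cnj (wavefun h \<rho> S x) * dir_deriv d (dir_deriv d (wavefun h \<rho> S)) x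
    = complex_of_real (\<rho> x) *
      ((complex_of_real (dir_deriv d \<rho> x / (2 * \<rho> x)) + \<i> * complex_of_real (dir_deriv d S x / h))\<^sup>2
      + (complex_of_real (dir_deriv d (dir_deriv d \<rho>) x / (2 * \<rho> x)
            - (dir_deriv d \<rho> x)\<^sup>2 / (2 * (\<rho> x)\<^sup>2))
          + \<i> * complex_of_real (dir_deriv d (dir_deriv d S) x / h)))"
    using cnj_mult_wavefun[of \<rho> x h S] pos[OF assms(1)]
    by (simp only: wavefun_dir_deriv2[OF assms(1)] mult.assoc[symmetric] less_imp_le)
  show ?thesis
    unfolding eq complex_eq_iff using pos[OF assms(1)] assms(2)
    by (simp add: Re_power2 Im_power2 power2_eq_square divide_simps) (simp add: algebra_simps)
qed

section \<open>Velocities, pressures and the Hamiltonian side\<close>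

lemma theta_dir_deriv:
  assumes "x \<in> W"
  shows "dir_deriv d (theta h \<rho>) x = - h / 2 * dir_deriv d \<rho> x / \<rho> x"
  using C2_on_dir_deriv[OF rho assms, of d] pos[OF assms]
  by (intro dir_deriv_eqI)
    (auto intro!: derivative_eq_intros
      simp: theta_def zeta0_def has_real_derivative_iff_has_vector_derivative[symmetric])

lemma vel_u_nth:
  assumes "x \<in> W"
  shows "vel_u h m \<rho> i x $ k = - h / (2 * m) * space_deriv i k \<rho> x / \<rho> x"
  using assms by (simp add: vel_u_def grad_def space_deriv_def theta_dir_deriv)

text \<open>The factor \<open>\<rho>\<close> cancels the denominator in \<open>vel_u\<close>
  throughout \<open>W\<close>, so the flux being differentiated is a constant multiple of the
  gradient of \<open>\<rho>\<close>.\<close>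

lemma pressure_P_eq:
  assumes "x \<in> W"
  shows "pressure_P h m \<rho> i x
    = - h\<^sup>2 / (4 * m) * (\<Sum>k\<in>UNIV. space_deriv i k (space_deriv i k \<rho>) x)"
proof -
  have "space_deriv i k (\<lambda>y. (\<rho> y *\<^sub>R vel_u h m \<rho> i y) $ k) x
      = - h / (2 * m) * space_deriv i k (space_deriv i k \<rho>) x" for k
    unfolding space_deriv_def
  proof (rule dir_deriv_eqI, rule has_vector_derivative_line_cong[OF W assms])
    show "(\<rho> y *\<^sub>R vel_u h m \<rho> i y) $ k
        = - h / (2 * m) * dir_deriv (0, axis i (axis k 1)) \<rho> y" if "y \<in> W" for y
      using pos[OF that] by (simp add: vel_u_nth[OF that] space_deriv_def)
  qed (intro has_vector_derivative_mult_right C2_on_dir_deriv2[OF rho W assms])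
  then show ?thesis
    by (simp add: pressure_P_def zeta0_def divergence_def sum_distrib_left power2_eq_square mult.assoc)
qed

lemma pressure_p_eq:
  assumes "x \<in> W"
  shows "pressure_p h m \<rho> S i x = - h / (2 * m) * (\<Sum>k\<in>UNIV.
      space_deriv i k \<rho> x * space_deriv i k S x + \<rho> x * space_deriv i k (space_deriv i k S) x)"
proof -
  have prod: "((\<lambda>s. \<rho> (x + s *\<^sub>R d) * dir_deriv d S (x + s *\<^sub>R d)) has_vector_derivative
      dir_deriv d \<rho> x * dir_deriv d S x + \<rho> x * dir_deriv d (dir_deriv d S) x) (at 0)" for d
    using has_vector_derivative_mult[OF C2_on_dir_deriv[OF rho assms, of d]
        C2_on_dir_deriv2[OF S W assms, of d d]]
    by (simp add: add.commute)
  have "space_deriv i k (\<lambda>y. (\<rho> y *\<^sub>R vel_v m S i y) $ k) x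
      = 1 / m * (space_deriv i k \<rho> x * space_deriv i k S x
          + \<rho> x * space_deriv i k (space_deriv i k S) x)" for k
    unfolding space_deriv_def
  proof (rule dir_deriv_eqI, rule has_vector_derivative_line_cong[OF W assms])
    show "(\<rho> y *\<^sub>R vel_v m S i y) $ k
        = 1 / m * (\<rho> y * dir_deriv (0, axis i (axis k 1)) S y)" if "y \<in> W" for y
      by (simp add: vel_v_def grad_def space_deriv_def)
  qed (intro has_vector_derivative_mult_right prod)
  then show ?thesis
    by (simp add: pressure_p_def zeta0_def divergence_def sum_distrib_left)
qed

text \<open>After multiplication by \<open>- h\<^sup>2 / (2 * m)\<close>, the three real terms of
  the second derivative become, in order, the \<open>pressure_P\<close> term, the kinetic term of
  \<open>vel_u\<close> and the kinetic term of \<open>vel_v\<close>; the imaginary term becomes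
  \<open>pressure_p\<close>.\<close>

lemma cnj_wavefun_hamiltonian:
  assumes "x \<in> W" "h > 0" "m > 0"
  shows "cnj (wavefun h \<rho> S x) * hamiltonian h m U (wavefun h \<rho> S) x = Complex
     ((\<Sum>i\<in>UNIV. 1/2 * mass_density m \<rho> x * (norm (vel_u h m \<rho> i x))\<^sup>2
         + 1/2 * mass_density m \<rho> x * (norm (vel_v m S i x))\<^sup>2
         + pressure_P h m \<rho> i x) + U x * \<rho> x)
     (\<Sum>i\<in>UNIV. pressure_p h m \<rho> S i x)"
proof -
  let ?\<psi> = "wavefun h \<rho> S"
  let ?D = "\<lambda>i k. space_deriv i k"
  have norm_sq: "(norm v)\<^sup>2 = (\<Sum>k\<in>UNIV. (v $ k)\<^sup>2)" for v :: "real^3"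
    unfolding power2_norm_eq_inner inner_vec_def by (simp add: power2_eq_square)
  have laplacian: "cnj (?\<psi> x) * laplacian i ?\<psi> x = (\<Sum>k\<in>UNIV. Complex
      (?D i k (?D i k \<rho>) x / 2 - (?D i k \<rho> x)\<^sup>2 / (4 * \<rho> x) - \<rho> x * (?D i k S x)\<^sup>2 / h\<^sup>2)
      ((?D i k \<rho> x * ?D i k S x + \<rho> x * ?D i k (?D i k S) x) / h))" for i
    using cnj_wavefun_dir_deriv2[OF assms(1,2)]
    by (simp add: laplacian_def divergence_def grad_def space_deriv_def sum_distrib_left)
  have re: "1/2 * mass_density m \<rho> x * (norm (vel_u h m \<rho> i x))\<^sup>2
        + 1/2 * mass_density m \<rho> x * (norm (vel_v m S i x))\<^sup>2 + pressure_P h m \<rho> i x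
      = - h\<^sup>2 / (2 * m) * Re (cnj (?\<psi> x) * laplacian i ?\<psi> x)" for i
    using pos[OF assms(1)] assms(2,3)
    unfolding laplacian Re_sum norm_sq vel_u_nth[OF assms(1)] pressure_P_eq[OF assms(1)]
      sum_distrib_left sum.distrib[symmetric]
    \<comment> \<open>The identity already holds for each coordinate \<open>k\<close> separately, so
      summands are compared.\<close>
    by (intro sum.cong refl)
      (simp add: mass_density_def vel_v_def grad_def power2_eq_square field_simps)
  have im: "pressure_p h m \<rho> S i x = - h\<^sup>2 / (2 * m) * Im (cnj (?\<psi> x) * laplacian i ?\<psi> x)" for i
    using assms(2,3)
    unfolding laplacian Im_sum pressure_p_eq[OF assms(1)] sum_distrib_left
    by (intro sum.cong refl) (simp add: power2_eq_square field_simps)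
  have "cnj (?\<psi> x) * hamiltonian h m U ?\<psi> x
      = complex_of_real (- h\<^sup>2 / (2 * m)) * (\<Sum>i\<in>UNIV. cnj (?\<psi> x) * laplacian i ?\<psi> x)
        + complex_of_real (U x) * (cnj (?\<psi> x) * ?\<psi> x)"
    by (simp add: hamiltonian_def sum_distrib_left[symmetric] algebra_simps)
  also have "cnj (?\<psi> x) * ?\<psi> x = complex_of_real (\<rho> x)"
    using cnj_mult_wavefun pos[OF assms(1)] by (metis less_imp_le)
  finally have eq: "cnj (?\<psi> x) * hamiltonian h m U ?\<psi> x
      = complex_of_real (- h\<^sup>2 / (2 * m)) * (\<Sum>i\<in>UNIV. cnj (?\<psi> x) * laplacian i ?\<psi> x)
        + complex_of_real (U x) * complex_of_real (\<rho> x)" .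
  have split: "complex_of_real c * z + complex_of_real a * complex_of_real b
      = Complex (c * Re z + a * b) (c * Im z)" for a b c z
    by (simp add: complex_eq_iff)
  show ?thesis
    unfolding eq re im sum_distrib_left[symmetric] Re_sum[symmetric] Im_sum[symmetric]
    by (rule split)
qed

end

section \<open>From pointwise identities to equivalences almost everywhere\<close>

theorem theorem3:
  fixes hbar m :: real
    and \<rho> S U :: "'n::finite event \<Rightarrow> real"
    and \<Psi> :: "'n event \<Rightarrow> complex"
  assumes hbar_pos: "hbar > 0" and m_pos: "m > 0"
    and rho_nonneg: "\<And>x. \<rho> x \<ge> 0"
    and rho_C2: "C2_ae \<rho>" and S_C2: "C2_ae S"
    and rho_zeros: "\<And>t. {r. \<rho> (t, r) = 0} \<in> null_sets lebesgue"
    and Psi: "\<Psi> = wavefun hbar \<rho> S"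
    and Psi_vanishes: "vanishes_at_infinity \<Psi>"
    and Psi_derivs_vanish: "derivs_vanish_at_infinity \<Psi>"
    and Psi_square_integrable: "\<And>t. integrable lebesgue (\<lambda>r. (cmod (\<Psi> (t, r)))\<^sup>2)"
    and normalized: "\<And>t. (LINT r|lebesgue. \<rho> (t, r)) = 1"
  shows
    "((AE x in lebesgue.
         Re (\<i> * complex_of_real hbar * cnj (\<Psi> x) * time_deriv \<Psi> x)
           = Re (cnj (\<Psi> x) * hamiltonian hbar m U \<Psi> x))
      \<longleftrightarrow>
      (AE x in lebesgue.
         energy_E S x * \<rho> x
           = (\<Sum>i\<in>UNIV. 1/2 * mass_density m \<rho> x * (norm (vel_u hbar m \<rho> i x))\<^sup>2
                + 1/2 * mass_density m \<rho> x * (norm (vel_v m S i x))\<^sup>2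
                + pressure_P hbar m \<rho> i x)
             + U x * \<rho> x))
     \<and>
     ((AE x in lebesgue.
         Im (\<i> * complex_of_real hbar * cnj (\<Psi> x) * time_deriv \<Psi> x)
           = Im (cnj (\<Psi> x) * hamiltonian hbar m U \<Psi> x))
      \<longleftrightarrow>
      (AE x in lebesgue.
         energy_F hbar \<rho> x * \<rho> x = (\<Sum>i\<in>UNIV. pressure_p hbar m \<rho> S i x)))"
proof -
  obtain W where W: "open W" "C2_on \<rho> W" "C2_on S W" "\<And>x. x \<in> W \<Longrightarrow> \<rho> x > 0"
    and AE: "AE x in lebesgue. x \<in> W"
    using AE_positive_C2[OF rho_nonneg rho_C2 S_C2 rho_zeros] by metis
  have lhs: "\<i> * complex_of_real hbar * cnj (\<Psi> x) * time_deriv \<Psi> x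
      = Complex (energy_E S x * \<rho> x) (energy_F hbar \<rho> x * \<rho> x)" if "x \<in> W" for x
  proof -
    \<comment> \<open>Multiplication by \<open>\<i>\<close> exchanges the two components: the phase
      derivative moves to the real part with a minus sign and gives \<open>energy_E\<close>, while
      the density derivative moves to the imaginary part and gives \<open>energy_F\<close>.\<close>
    have "\<i> * complex_of_real hbar * cnj (\<Psi> x) * time_deriv \<Psi> x
        = \<i> * complex_of_real hbar *
          Complex (time_deriv \<rho> x / 2) (\<rho> x * time_deriv S x / hbar)"
      using cnj_wavefun_dir_deriv[OF W that hbar_pos]
      by (simp add: Psi time_deriv_def mult.assoc)
    also have "\<dots> = Complex (energy_E S x * \<rho> x) (energy_F hbar \<rho> x * \<rho> x)"
      using W(4)[OF that] hbar_pos theta_dir_deriv[OF W that, of _ hbar]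
      by (simp add: energy_E_def energy_F_def time_deriv_def complex_eq_iff)
    finally show ?thesis .
  qed
  note rhs = cnj_wavefun_hamiltonian[OF W _ hbar_pos m_pos, of _ U, folded Psi]
  show ?thesis
    \<comment> \<open>It suffices that the two predicates agree almost everywhere; on
      \<open>W\<close> the rewriting turns both sides of each equivalence into the same
      equation.\<close>
    by (intro conjI eventually_subst; use AE in eventually_elim) (simp_all only: lhs rhs complex.sel)
qed

end
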